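(* Let $A>0$. There is a constant $c>0$ depending only on $A$ such that the following holds. Let $d\ge1$, $X=[0,1]^d$, $Y=[-A,A]$, let $\varrho$ be a Borel probability measure on $X\times Y$ with marginal $\varrho_X$ on $X$ and regression function $f_\varrho$. Let $\mathbf{M}=\{M_v\}_{v\in T}$ be any finite family of measurable functions on $X$ with $0\le M_v(x)\le 1$ for all $v\in T$, $x\in X$, and $\sum_{v\in T}M_v(x)=1$ for all $x\in X$, and put $N=|T|$. Then for every integer $m\ge1$ and every $\eta>0$, $$\mathrm{Prob}\{\|Q_{\mathbf{M}}f_\varrho-f_{\mathbf{z}}\|>\eta\}\le 4N e^{-\frac{c m\eta^2}{N}},$$ where the probability is with respect to the sample $\mathbf{z}\sim\varrho^m$ and $\|\cdot\|$ is the norm of $L^2(X,\varrho_X)$.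
   Context: Disintegrate $d\varrho(x,y)=d\varrho(y|x)\,d\varrho_X(x)$, where $\varrho_X(S)=\varrho(S\times Y)$. The regression function is $f_\varrho(x)=\int_Y y\,d\varrho(y|x)$. The norm $\|\cdot\|$ is that of $L^2(X,\varrho_X)$. The sample $\mathbf{z}=(z_1,\dots,z_m)$ consists of $m$ independent observations $z_j=(x_j,y_j)\in X\times Y$, identically distributed according to $\varrho$ (so $\mathbf{z}\sim\varrho^m$). For a finite family $\mathbf{M}=\{M_v\}_{v\in T}$ of measurable functions $M_v:X\to[0,1]$ with $\sum_{v\in T}M_v\equiv 1$, define for $f\in L^2(X,\varrho_X)$ $$Q_{\mathbf{M}}f(x)=\sum_{v\in T}c_v(f)M_v(x),\quad c_v(f)=\frac{\alpha_v(f)}{\varrho_v},\quad \alpha_v(f)=\int_X fM_v\,d\varrho_X,\quad \varrho_v=\int_X M_v\,d\varrho_X,$$ with the convention $c_v(f)=0$ if $\varrho_v=0$. The estimator (depending on $\mathbf{M}$ and $\mathbf{z}$) is $$f_{\mathbf{z}}(x)=\sum_{v\in T}c_v(\mathbf{z})M_v(x),\quad c_v(\mathbf{z})=\frac{\alpha_v(\mathbf{z})}{\varrho_v(\mathbf{z})},\quad \alpha_v(\mathbf{z})=\frac1m\sum_{j=1}^m y_jM_v(x_j),\quad \varrho_v(\mathbf{z})=\frac1m\sum_{j=1}^m M_v(x_j),$$ with the convention $c_v(\mathbf{z})=0$ if $\varrho_v(\mathbf{z})=0$. *)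

theory Defs
  imports "HOL-Probability.Probability"
begin

text \<open>The cube \<open>[0,1]^d\<close> is carried by extensional functions on \<open>{..<d}\<close>, so that the
  dimension is a term-level variable; the (countable) product of the Borel \<open>\<sigma>\<close>-algebras is the
  Borel \<open>\<sigma>\<close>-algebra of the product.\<close>

definition cube_space :: "nat \<Rightarrow> (nat \<Rightarrow> real) measure" where
  "cube_space d = PiM {..<d} (\<lambda>_. restrict_space borel {0..1})"

definition label_space :: "real \<Rightarrow> real measure" where
  "label_space A = restrict_space borel {-A..A}"

definition marginal :: "'x measure \<Rightarrow> ('x \<times> 'y) measure \<Rightarrow> 'x measure" where
  "marginal X \<rho> = distr \<rho> X fst"

text \<open>\<open>\<kappa> x\<close> is the conditional probability measure \<open>\<rho>(\<cdot>|x)\<close> on \<open>Y\<close>.\<close>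

definition disintegration ::
  "'x measure \<Rightarrow> 'y measure \<Rightarrow> ('x \<times> 'y) measure \<Rightarrow> ('x \<Rightarrow> 'y measure) \<Rightarrow> bool" where
  "disintegration X Y \<rho> \<kappa> \<longleftrightarrow>
     \<kappa> \<in> X \<rightarrow>\<^sub>M prob_algebra Y \<and>
     (\<forall>S \<in> sets (X \<Otimes>\<^sub>M Y).
        emeasure \<rho> S = (\<integral>\<^sup>+x. (\<integral>\<^sup>+y. indicator S (x, y) \<partial>\<kappa> x) \<partial>marginal X \<rho>))"

definition regression_function :: "('x \<Rightarrow> real measure) \<Rightarrow> 'x \<Rightarrow> real" where
  "regression_function \<kappa> x = (\<integral>y. y \<partial>\<kappa> x)"

definition L2_norm :: "'x measure \<Rightarrow> ('x \<Rightarrow> real) \<Rightarrow> real" where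
  "L2_norm \<mu> f = sqrt (\<integral>x. (f x)\<^sup>2 \<partial>\<mu>)"

definition coeff_pop :: "'x measure \<Rightarrow> ('x \<Rightarrow> real) \<Rightarrow> ('x \<Rightarrow> real) \<Rightarrow> real" where
  "coeff_pop \<mu> Mv f =
     (if (\<integral>x. Mv x \<partial>\<mu>) = 0 then 0 else (\<integral>x. f x * Mv x \<partial>\<mu>) / (\<integral>x. Mv x \<partial>\<mu>))"

definition quasi_proj ::
  "'x measure \<Rightarrow> 'v set \<Rightarrow> ('v \<Rightarrow> 'x \<Rightarrow> real) \<Rightarrow> ('x \<Rightarrow> real) \<Rightarrow> 'x \<Rightarrow> real" where
  "quasi_proj \<mu> T M f x = (\<Sum>v\<in>T. coeff_pop \<mu> (M v) f * M v x)"

definition alpha_emp :: "nat \<Rightarrow> ('x \<Rightarrow> real) \<Rightarrow> (nat \<Rightarrow> 'x \<times> real) \<Rightarrow> real" where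
  "alpha_emp m Mv z = (\<Sum>j<m. snd (z j) * Mv (fst (z j))) / real m"

definition rho_emp :: "nat \<Rightarrow> ('x \<Rightarrow> real) \<Rightarrow> (nat \<Rightarrow> 'x \<times> real) \<Rightarrow> real" where
  "rho_emp m Mv z = (\<Sum>j<m. Mv (fst (z j))) / real m"

definition coeff_emp :: "nat \<Rightarrow> ('x \<Rightarrow> real) \<Rightarrow> (nat \<Rightarrow> 'x \<times> real) \<Rightarrow> real" where
  "coeff_emp m Mv z = (if rho_emp m Mv z = 0 then 0 else alpha_emp m Mv z / rho_emp m Mv z)"

definition estimator ::
  "nat \<Rightarrow> 'v set \<Rightarrow> ('v \<Rightarrow> 'x \<Rightarrow> real) \<Rightarrow> (nat \<Rightarrow> 'x \<times> real) \<Rightarrow> 'x \<Rightarrow> real" where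
  "estimator m T M z x = (\<Sum>v\<in>T. coeff_emp m (M v) z * M v x)"

end

theory Submission
  imports Defs
begin

text \<open>
  Since the \<open>M\<^sub>v\<close> form a partition of unity, Cauchy--Schwarz gives
  \<open>\<parallel>Q f - f\<^sub>z\<parallel>\<^sup>2 \<le> \<Sum>\<^sub>v \<rho>\<^sub>v (c\<^sub>v - c\<^sub>v(z))\<^sup>2\<close>. If the left-hand side exceeds \<open>\<eta>\<^sup>2\<close>, some \<open>v\<close> satisfies
  \<open>\<bar>c\<^sub>v - c\<^sub>v(z)\<bar> > s\<close> with \<open>s\<^sup>2 \<rho>\<^sub>v = \<eta>\<^sup>2 / N\<close>, and \<open>s \<le> 2 A\<close> because both coefficients lie in
  \<open>[-A, A]\<close>. The ratio is linearised: \<open>c\<^sub>v(z) \<ge> c\<^sub>v + s\<close> implies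
  \<open>\<Sum>\<^sub>j (y\<^sub>j - c\<^sub>v - s) M\<^sub>v(x\<^sub>j) \<ge> 0\<close>, also when \<open>\<rho>\<^sub>v(z) = 0\<close>. The summands have mean \<open>-s \<rho>\<^sub>v\<close> and
  second moment at most \<open>16 A\<^sup>2 \<rho>\<^sub>v\<close>, so the exponential Markov inequality with parameter
  \<open>s / (32 A\<^sup>2)\<close> bounds the probability by \<open>exp (- m s\<^sup>2 \<rho>\<^sub>v / (64 A\<^sup>2))\<close>; the opposite deviation is
  symmetric, and a union bound over \<open>v\<close> concludes with \<open>c = 1 / (64 A\<^sup>2)\<close>.
\<close>

section \<open>Exponential moments and a one-sided tail bound under the product measure\<close>

lemma exp_le_quadratic:
  fixes x :: real
  assumes "\<bar>x\<bar> \<le> 1"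
  shows "exp x \<le> 1 + x + x\<^sup>2"
proof (cases "0 \<le> x")
  case True
  then show ?thesis using assms by (intro exp_bound) auto
next
  case False
  define y where "y = - x"
  have y: "0 \<le> y" "y \<le> 1" using False assms by (auto simp: y_def)
  have pos: "0 < 1 - y + y\<^sup>2" using y by (cases "y = 1") (auto simp: add_pos_nonneg)
  \<comment> \<open>The product is \<open>1 + y ^ 3\<close>. Together with
    \<open>1 + y \<le> exp y\<close> this bounds the reciprocal of \<open>exp y\<close>, which is
    the negative case.\<close>
  have "1 \<le> (1 + y) * (1 - y + y\<^sup>2)"
    using y by (simp add: algebra_simps power2_eq_square)
  also have "\<dots> \<le> exp y * (1 - y + y\<^sup>2)"
    using pos by (intro mult_right_mono) (auto intro: exp_ge_add_one_self)
  finally have "exp (- y) \<le> 1 - y + y\<^sup>2"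
    by (simp add: exp_minus field_simps)
  then show ?thesis by (simp add: y_def)
qed

text \<open>Integrate the quadratic bound, then use \<open>1 + u \<le> exp u\<close>. The true
  second moment stays in the exponent, as in Bernstein's inequality; a bound through the range of
  \<open>W\<close> alone would lose the factor \<rho>\<open>\<^sub>v\<close> in the final
  rate.\<close>

lemma (in prob_space) expectation_exp_le:
  fixes W :: "'a \<Rightarrow> real"
  assumes [measurable]: "W \<in> borel_measurable M"
    and bd: "\<And>x. x \<in> space M \<Longrightarrow> \<bar>W x\<bar> \<le> 1"
  shows "expectation (\<lambda>x. exp (W x)) \<le> exp (expectation W + expectation (\<lambda>x. (W x)\<^sup>2))"
proof -
  have i1: "integrable M W"
    using bd by (intro integrable_const_bound[where B = 1] AE_I2) simp_all
  have i2: "integrable M (\<lambda>x. (W x)\<^sup>2)"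
    using bd by (intro integrable_const_bound[where B = 1]) (auto simp: abs_square_le_1)
  have i3: "integrable M (\<lambda>x. exp (W x))"
    using bd by (intro integrable_const_bound[where B = "exp 1"]) (auto simp: abs_le_iff)
  have "expectation (\<lambda>x. exp (W x)) \<le> expectation (\<lambda>x. 1 + W x + (W x)\<^sup>2)"
    using i1 i2 i3 bd by (intro integral_mono exp_le_quadratic) auto
  also have "\<dots> = 1 + (expectation W + expectation (\<lambda>x. (W x)\<^sup>2))"
    using i1 i2 by (simp add: prob_space)
  also have "\<dots> \<le> exp (expectation W + expectation (\<lambda>x. (W x)\<^sup>2))"
    by (rule exp_ge_add_one_self)
  finally show ?thesis .
qed

text \<open>Chernoff's method with the parameter already absorbed into \<open>W\<close>: the event
  says that the product of the \<open>exp (W (z j))\<close> is at least 1, so Markov's inequality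
  bounds its probability by the mean of that product, which factorises under the product
  measure.\<close>

lemma (in prob_space) prob_sum_nonneg_le:
  fixes W :: "'a \<Rightarrow> real"
  assumes [measurable]: "W \<in> borel_measurable M"
    and bd: "\<And>x. x \<in> space M \<Longrightarrow> \<bar>W x\<bar> \<le> 1"
  shows "measure (PiM {..<m} (\<lambda>_. M)) {z \<in> space (PiM {..<m} (\<lambda>_. M)). 0 \<le> (\<Sum>j<m. W (z j))}
    \<le> exp (real m * (expectation W + expectation (\<lambda>x. (W x)\<^sup>2)))"
proof -
  interpret P: product_prob_space "\<lambda>_::nat. M" "{..<m}" ..
  let ?P = "PiM {..<m} (\<lambda>_. M)"
  have int: "integrable M (\<lambda>x. exp (W x))"
    using bd by (intro integrable_const_bound[where B = "exp 1"]) (auto simp: abs_le_iff)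
  have "measure ?P {z \<in> space ?P. 0 \<le> (\<Sum>j<m. W (z j))}
      = measure ?P {z \<in> space ?P. 1 \<le> (\<Prod>j<m. exp (W (z j)))}"
    by (simp flip: exp_sum)
  also have "\<dots> \<le> (\<integral>z. (\<Prod>j<m. exp (W (z j))) \<partial>?P) / 1"
    using P.product_integrable_prod[of "{..<m}" "\<lambda>_ x. exp (W x)"] int
    by (intro integral_Markov_inequality_measure[where A = "{}"]) (auto intro!: always_eventually prod_nonneg)
  also have "\<dots> = expectation (\<lambda>x. exp (W x)) ^ m"
    using P.product_integral_prod[of "{..<m}" "\<lambda>_ x. exp (W x)"] int by simp
  also have "\<dots> \<le> exp (expectation W + expectation (\<lambda>x. (W x)\<^sup>2)) ^ m"
    using bd by (intro power_mono expectation_exp_le) auto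
  finally show ?thesis by (simp add: exp_of_nat_mult)
qed

text \<open>Each summand has mean \<open>- s * expectation h\<close>, because \<open>g\<close> is
  centred with respect to the weight \<open>h\<close>, and its second moment is also at most a
  multiple of \<open>expectation h\<close>. Drift and variance therefore scale alike, and the
  exponent is linear in the mean weight however small that is.\<close>

lemma (in prob_space) prob_weighted_sum_nonneg_le:
  fixes g h :: "'a \<Rightarrow> real"
  assumes [measurable]: "g \<in> borel_measurable M" "h \<in> borel_measurable M"
    and g: "\<And>x. x \<in> space M \<Longrightarrow> \<bar>g x\<bar> \<le> B"
    and h: "\<And>x. x \<in> space M \<Longrightarrow> 0 \<le> h x \<and> h x \<le> 1"
    and s: "0 < s" "s \<le> B"
    and mean: "expectation (\<lambda>x. g x * h x) = 0"
  shows "measure (PiM {..<m} (\<lambda>_. M))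
      {z \<in> space (PiM {..<m} (\<lambda>_. M)). 0 \<le> (\<Sum>j<m. (g (z j) - s) * h (z j))}
    \<le> exp (- (real m * s\<^sup>2 * expectation h / (16 * B\<^sup>2)))"
proof -
  have B: "B > 0" using s by simp
  \<comment> \<open>This value minimises \<open>- l * s + l\<^sup>2 * (2 * B)\<^sup>2\<close> over
    \<open>l\<close>; the minimum is \<open>- s\<^sup>2 / (16 * B\<^sup>2)\<close>.\<close>
  define l where "l = s / (8 * B\<^sup>2)"
  have l: "l > 0" using s B by (simp add: l_def)
  define W where "W = (\<lambda>x. l * ((g x - s) * h x))"
  have gs: "\<bar>g x - s\<bar> \<le> 2 * B" if "x \<in> space M" for x
    using g[OF that] s by linarith
  have gh: "\<bar>(g x - s) * h x\<bar> \<le> 2 * B" if "x \<in> space M" for x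
    using mult_mono[OF gs[OF that], of "\<bar>h x\<bar>" 1] h[OF that] B by (simp add: abs_mult)
  \<comment> \<open>The left side equals \<open>s / (4 * B)\<close>, at most 1/4 by
    \<open>s \<le> B\<close>, so \<open>W\<close> stays in the range where the quadratic bound on
    \<open>exp\<close> is valid.\<close>
  have lB: "l * (2 * B) \<le> 1"
    using s B by (simp add: l_def power2_eq_square field_simps)
  have Wbd: "\<bar>W x\<bar> \<le> 1" if "x \<in> space M" for x
    using order_trans[OF mult_left_mono[OF gh[OF that], of l] lB] l
    by (simp add: W_def abs_mult[of l])
  have [measurable]: "W \<in> borel_measurable M" by (simp add: W_def)
  have ih: "integrable M h"
    using h by (intro integrable_const_bound[where B = 1]) (auto simp: abs_le_iff)
  have igh: "integrable M (\<lambda>x. g x * h x)"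
  proof (rule integrable_const_bound[where B = B])
    show "AE x in M. norm (g x * h x) \<le> B"
    proof (rule AE_I2)
      fix x assume "x \<in> space M"
      from mult_mono[OF g[OF this], of "\<bar>h x\<bar>" 1] h[OF this] B
      show "norm (g x * h x) \<le> B" by (simp add: abs_mult)
    qed
  qed simp
  have iW2: "integrable M (\<lambda>x. (W x)\<^sup>2)"
    using Wbd by (intro integrable_const_bound[where B = 1]) (auto simp: abs_square_le_1)
  have "expectation W = expectation (\<lambda>x. l * (g x * h x) - l * s * h x)"
    by (simp add: W_def algebra_simps)
  also have "\<dots> = - (l * s * expectation h)"
    using ih igh mean by simp
  finally have EW: "expectation W = - (l * s * expectation h)" .
  have "expectation (\<lambda>x. (W x)\<^sup>2) \<le> expectation (\<lambda>x. l\<^sup>2 * (2 * B)\<^sup>2 * h x)"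
  proof (rule integral_mono)
    fix x assume x: "x \<in> space M"
    have "(g x - s)\<^sup>2 \<le> (2 * B)\<^sup>2"
      using gs[OF x] B by (intro iffD1[OF abs_le_square_iff]) simp
    \<comment> \<open>Since \<open>h\<close> takes values in the unit interval, its square can be
      replaced by \<open>h\<close> itself; this is what makes the second moment proportional to
      \<open>expectation h\<close>.\<close>
    moreover have "(h x)\<^sup>2 \<le> h x"
      using h[OF x] by (simp add: power2_eq_square mult_left_le)
    ultimately have "(g x - s)\<^sup>2 * (h x)\<^sup>2 \<le> (2 * B)\<^sup>2 * h x"
      by (intro mult_mono) auto
    then show "(W x)\<^sup>2 \<le> l\<^sup>2 * (2 * B)\<^sup>2 * h x"
      by (simp add: W_def power_mult_distrib mult.assoc mult_left_mono)
  qed (use iW2 ih in auto)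
  then have EW2: "expectation (\<lambda>x. (W x)\<^sup>2) \<le> l\<^sup>2 * (2 * B)\<^sup>2 * expectation h" by simp
  have "{z \<in> space (PiM {..<m} (\<lambda>_. M)). 0 \<le> (\<Sum>j<m. (g (z j) - s) * h (z j))}
      = {z \<in> space (PiM {..<m} (\<lambda>_. M)). 0 \<le> (\<Sum>j<m. W (z j))}"
    using l by (simp add: W_def zero_le_mult_iff flip: sum_distrib_left)
  then have "measure (PiM {..<m} (\<lambda>_. M))
      {z \<in> space (PiM {..<m} (\<lambda>_. M)). 0 \<le> (\<Sum>j<m. (g (z j) - s) * h (z j))}
      \<le> exp (real m * (expectation W + expectation (\<lambda>x. (W x)\<^sup>2)))"
    using prob_sum_nonneg_le[of W m] Wbd by simp
  also have "\<dots> \<le> exp (real m * (- (l * s * expectation h) + l\<^sup>2 * (2 * B)\<^sup>2 * expectation h))"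
    using EW EW2 by (simp add: mult_left_mono)
  also have "- (l * s * expectation h) + l\<^sup>2 * (2 * B)\<^sup>2 * expectation h
      = - (s\<^sup>2 * expectation h / (16 * B\<^sup>2))"
    using B by (simp add: l_def power2_eq_square field_simps)
  finally show ?thesis by (simp add: mult.assoc)
qed

section \<open>Disintegration and integrals against the regression function\<close>

text \<open>\<open>disintegration\<close> gives the iterated integral for indicators only; the
  standard induction over nonnegative measurable functions carries it to all of them. The auxiliary
  \<open>inner\<close> makes the inner integral measurable in \<open>x\<close>, so that linearity
  and monotone convergence apply to the outer one.\<close>

lemma nn_integral_disintegration:
  assumes D: "disintegration X Y \<rho> \<kappa>"
    and sets: "sets \<rho> = sets (X \<Otimes>\<^sub>M Y)"
    and g: "g \<in> borel_measurable (X \<Otimes>\<^sub>M Y)"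
  shows "(\<integral>\<^sup>+z. g z \<partial>\<rho>) = (\<integral>\<^sup>+x. (\<integral>\<^sup>+y. g (x, y) \<partial>\<kappa> x) \<partial>marginal X \<rho>)"
proof -
  have K: "\<kappa> \<in> X \<rightarrow>\<^sub>M prob_algebra Y"
    and E: "\<And>S. S \<in> sets (X \<Otimes>\<^sub>M Y) \<Longrightarrow>
      emeasure \<rho> S = (\<integral>\<^sup>+x. (\<integral>\<^sup>+y. indicator S (x, y) \<partial>\<kappa> x) \<partial>marginal X \<rho>)"
    using D by (auto simp: disintegration_def)
  have [measurable]: "\<kappa> \<in> X \<rightarrow>\<^sub>M subprob_algebra Y"
    using K by (rule measurable_prob_algebraD)
  have [measurable_cong]: "sets \<rho> = sets (X \<Otimes>\<^sub>M Y)" "sets (marginal X \<rho>) = sets X"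
    using sets by (auto simp: marginal_def)
  have sp: "space (marginal X \<rho>) = space X" by (simp add: marginal_def)
  have k: "sets (\<kappa> x) = sets Y" if "x \<in> space X" for x
    using measurable_space[OF K that] by (simp add: space_prob_algebra)
  have sec: "(\<lambda>y. u (x, y)) \<in> borel_measurable (\<kappa> x)"
    if "u \<in> borel_measurable (X \<Otimes>\<^sub>M Y)" "x \<in> space X" for u x
    using that k by (simp cong: measurable_cong_sets)
  have inner: "(\<lambda>x. \<integral>\<^sup>+y. u (x, y) \<partial>\<kappa> x) \<in> borel_measurable (marginal X \<rho>)"
    if [measurable]: "u \<in> borel_measurable (X \<Otimes>\<^sub>M Y)" for u
    by (rule nn_integral_measurable_subprob_algebra2[where N = Y]) measurable
  show ?thesis
    using g
  proof (induction g rule: borel_measurable_induct)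
    case (cong f g)
    have "(\<integral>\<^sup>+z. f z \<partial>\<rho>) = (\<integral>\<^sup>+z. g z \<partial>\<rho>)"
      using cong(3) sets_eq_imp_space_eq[OF sets] by (intro nn_integral_cong) simp
    moreover have "(\<integral>\<^sup>+x. (\<integral>\<^sup>+y. f (x, y) \<partial>\<kappa> x) \<partial>marginal X \<rho>)
        = (\<integral>\<^sup>+x. (\<integral>\<^sup>+y. g (x, y) \<partial>\<kappa> x) \<partial>marginal X \<rho>)"
      using cong(3) sp sets_eq_imp_space_eq[OF k]
      by (intro nn_integral_cong) (simp add: space_pair_measure)
    ultimately show ?case using cong by simp
  next
    case (set S)
    then show ?case using E sets by simp
  next
    case (mult u c)
    have "(\<integral>\<^sup>+x. (\<integral>\<^sup>+y. c * u (x, y) \<partial>\<kappa> x) \<partial>marginal X \<rho>)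
        = (\<integral>\<^sup>+x. c * (\<integral>\<^sup>+y. u (x, y) \<partial>\<kappa> x) \<partial>marginal X \<rho>)"
      using sp sec mult by (intro nn_integral_cong nn_integral_cmult) auto
    then show ?case using mult inner by (simp add: nn_integral_cmult)
  next
    case (add u v)
    have "(\<integral>\<^sup>+x. (\<integral>\<^sup>+y. v (x, y) + u (x, y) \<partial>\<kappa> x) \<partial>marginal X \<rho>)
        = (\<integral>\<^sup>+x. (\<integral>\<^sup>+y. v (x, y) \<partial>\<kappa> x) + (\<integral>\<^sup>+y. u (x, y) \<partial>\<kappa> x) \<partial>marginal X \<rho>)"
      using sp sec add by (intro nn_integral_cong nn_integral_add) auto
    then show ?case using add inner by (simp add: nn_integral_add)
  next
    \<comment> \<open>Monotone convergence is used three times: under \<rho>, under the marginal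
      (with \<open>I\<close>), and under each \<open>\<kappa> x\<close> (with
      \<open>U\<close>).\<close>
    case (seq U)
    have U: "incseq (\<lambda>i y. U i (x, y))" for x
      using seq(3) by (auto simp: incseq_def le_fun_def)
    have I: "incseq (\<lambda>i x. \<integral>\<^sup>+y. U i (x, y) \<partial>\<kappa> x)"
      using seq(3) by (auto simp: incseq_def le_fun_def intro!: nn_integral_mono)
    have "(\<integral>\<^sup>+z. (SUP i. U i) z \<partial>\<rho>) = (SUP i. \<integral>\<^sup>+z. U i z \<partial>\<rho>)"
      using seq by (simp add: image_comp) (subst nn_integral_monotone_convergence_SUP, auto)
    also have "\<dots> = (SUP i. \<integral>\<^sup>+x. (\<integral>\<^sup>+y. U i (x, y) \<partial>\<kappa> x) \<partial>marginal X \<rho>)"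
      using seq by simp
    also have "\<dots> = (\<integral>\<^sup>+x. (SUP i. \<integral>\<^sup>+y. U i (x, y) \<partial>\<kappa> x) \<partial>marginal X \<rho>)"
      using I inner seq by (intro nn_integral_monotone_convergence_SUP[symmetric]) auto
    also have "\<dots> = (\<integral>\<^sup>+x. (\<integral>\<^sup>+y. (SUP i. U i (x, y)) \<partial>\<kappa> x) \<partial>marginal X \<rho>)"
      using U sec seq sp
      by (intro nn_integral_cong nn_integral_monotone_convergence_SUP[symmetric]) auto
    finally show ?case by (simp add: image_comp)
  qed
qed


lemma space_label_space: "space (label_space A) = {-A..A}"
  by (simp add: label_space_def space_restrict_space)

lemma measurable_label_space: "(\<lambda>y. y) \<in> borel_measurable (label_space A)"
  by (simp add: label_space_def measurable_restrict_space1)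

lemma measurable_snd_label_space:
  "sets \<rho> = sets (X \<Otimes>\<^sub>M label_space A) \<Longrightarrow> snd \<in> borel_measurable \<rho>"
  using measurable_compose[OF measurable_snd measurable_label_space, of X A]
  by (simp cong: measurable_cong_sets)

text \<open>Identifies the numerator of the population coefficient as the mean of
  \<open>y * h x\<close> under \<rho>, the quantity that the empirical numerator averages. Labels
  are shifted by \<open>A\<close> to become nonnegative, so that the iterated integral for
  nonnegative functions applies; the added term \<open>A * h\<close> has equal integrals on both
  sides and cancels at the end.\<close>

lemma integral_regression_function:
  assumes P: "prob_space \<rho>"
    and sets: "sets \<rho> = sets (X \<Otimes>\<^sub>M label_space A)"
    and D: "disintegration X (label_space A) \<rho> \<kappa>"
    and h [measurable]: "h \<in> borel_measurable X"
    and h01: "\<And>x. x \<in> space X \<Longrightarrow> 0 \<le> h x \<and> h x \<le> 1"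
  shows "(\<integral>x. regression_function \<kappa> x * h x \<partial>marginal X \<rho>) = (\<integral>z. snd z * h (fst z) \<partial>\<rho>)"
proof -
  interpret R: prob_space \<rho> by fact
  have [measurable_cong]: "sets \<rho> = sets (X \<Otimes>\<^sub>M label_space A)" "sets (marginal X \<rho>) = sets X"
    using sets by (auto simp: marginal_def)
  note [measurable] = measurable_snd_label_space[OF sets]
  have sp: "space (marginal X \<rho>) = space X" by (simp add: marginal_def)
  have spR: "space \<rho> = space X \<times> {-A..A}"
    using sets_eq_imp_space_eq[OF sets] by (simp add: space_pair_measure space_label_space)
  interpret U: prob_space "marginal X \<rho>"
    unfolding marginal_def by (rule R.prob_space_distr) measurable
  have K: "\<kappa> \<in> X \<rightarrow>\<^sub>M prob_algebra (label_space A)"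
    using D by (simp add: disintegration_def)
  have [measurable]: "\<kappa> \<in> X \<rightarrow>\<^sub>M subprob_algebra (label_space A)"
    using K by (rule measurable_prob_algebraD)
  let ?f = "regression_function \<kappa>"
  have [measurable]: "?f \<in> borel_measurable X"
    unfolding regression_function_def
    by (rule measurable_compose[OF _ integral_measurable_subprob_algebra[OF measurable_label_space]])
       measurable
  \<comment> \<open>The bound on \<open>?f x\<close> is proved alongside because it makes the
    shifted integrand over \<open>X\<close> nonnegative and \<open>?f x * h x\<close>
    integrable.\<close>
  have inner: "(\<integral>\<^sup>+y. ennreal ((y + A) * h x) \<partial>\<kappa> x) = ennreal ((?f x + A) * h x) \<and> \<bar>?f x\<bar> \<le> A"
    if x: "x \<in> space X" for x
  proof -
    have k: "sets (\<kappa> x) = sets (label_space A)" and "prob_space (\<kappa> x)"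
      using measurable_space[OF K x] by (auto simp: space_prob_algebra)
    interpret k: prob_space "\<kappa> x" by fact
    have spk: "space (\<kappa> x) = {-A..A}"
      using sets_eq_imp_space_eq[OF k] by (simp add: space_label_space)
    have [measurable]: "(\<lambda>y. y) \<in> borel_measurable (\<kappa> x)"
      using measurable_label_space[of A] k by (simp cong: measurable_cong_sets)
    have i: "integrable (\<kappa> x) (\<lambda>y. y)"
      using spk by (intro k.integrable_const_bound[where B = A] AE_I2) auto
    have "(\<integral>\<^sup>+y. ennreal ((y + A) * h x) \<partial>\<kappa> x) = ennreal (\<integral>y. (y + A) * h x \<partial>\<kappa> x)"
      using i spk h01[OF x] by (intro nn_integral_eq_integral AE_I2) auto
    moreover have "(\<integral>y. (y + A) * h x \<partial>\<kappa> x) = (?f x + A) * h x"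
      using i by (simp add: regression_function_def k.prob_space)
    moreover have "\<bar>?f x\<bar> \<le> A"
      unfolding regression_function_def abs_le_iff
      using k.integral_le_const[OF i, of A] k.integral_ge_const[OF i, of "-A"] spk
      by (force intro: AE_I2)
    ultimately show ?thesis by (simp only: simp_thms)
  qed
  have "(\<integral>z. (snd z + A) * h (fst z) \<partial>\<rho>) = enn2real (\<integral>\<^sup>+z. ennreal ((snd z + A) * h (fst z)) \<partial>\<rho>)"
    using spR h01 by (intro integral_eq_nn_integral AE_I2) auto
  also have "(\<integral>\<^sup>+z. ennreal ((snd z + A) * h (fst z)) \<partial>\<rho>)
      = (\<integral>\<^sup>+x. (\<integral>\<^sup>+y. ennreal ((y + A) * h x) \<partial>\<kappa> x) \<partial>marginal X \<rho>)"
    by (subst nn_integral_disintegration[OF D sets]) auto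
  also have "\<dots> = (\<integral>\<^sup>+x. ennreal ((?f x + A) * h x) \<partial>marginal X \<rho>)"
    using inner sp by (intro nn_integral_cong) auto
  also have "enn2real \<dots> = (\<integral>x. (?f x + A) * h x \<partial>marginal X \<rho>)"
    using inner h01 sp
    by (intro integral_eq_nn_integral[symmetric] AE_I2) (force simp: abs_le_iff)+
  finally have eq: "(\<integral>z. (snd z + A) * h (fst z) \<partial>\<rho>) = (\<integral>x. (?f x + A) * h x \<partial>marginal X \<rho>)" .
  have hb: "\<bar>a * h x\<bar> \<le> A" if "\<bar>a\<bar> \<le> A" "x \<in> space X" for a x
    using mult_mono[OF that(1), of "\<bar>h x\<bar>" 1] h01[OF that(2)] that(1) by (simp add: abs_mult)
  have i1: "integrable \<rho> (\<lambda>z. snd z * h (fst z))"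
    using spR hb by (intro R.integrable_const_bound[where B = A] AE_I2) (auto simp: abs_le_iff)
  have i2: "integrable \<rho> (\<lambda>z. h (fst z))"
    using spR h01 by (intro R.integrable_const_bound[where B = 1] AE_I2) auto
  have i3: "integrable (marginal X \<rho>) (\<lambda>x. ?f x * h x)"
    using sp hb inner by (intro U.integrable_const_bound[where B = A] AE_I2) auto
  have i4: "integrable (marginal X \<rho>) h"
    using sp h01 by (intro U.integrable_const_bound[where B = 1] AE_I2) (auto simp: abs_le_iff)
  have "(\<integral>x. h x \<partial>marginal X \<rho>) = (\<integral>z. h (fst z) \<partial>\<rho>)"
    unfolding marginal_def by (rule integral_distr) measurable
  then show ?thesis
    using eq i1 i2 i3 i4 by (simp add: distrib_right)
qed

section \<open>Empirical coefficients: linearisation and deviation from the population value\<close>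

text \<open>Clears the random denominator: the sums equal the difference between coefficient and
  \<open>e\<close>, with the matching sign, times the total weight \<open>r\<close>, which is
  nonnegative. A statement about a ratio becomes one about a sum of independent terms.\<close>

lemma sum_diff_coeff_emp_nonneg:
  assumes m: "m \<ge> 1" and nn: "\<And>j. j < m \<Longrightarrow> 0 \<le> h (fst (z j))"
  shows "e \<le> coeff_emp m h z \<Longrightarrow> 0 \<le> (\<Sum>j<m. (snd (z j) - e) * h (fst (z j)))"
    and "coeff_emp m h z \<le> e \<Longrightarrow> 0 \<le> (\<Sum>j<m. (e - snd (z j)) * h (fst (z j)))"
proof -
  define a where "a = (\<Sum>j<m. snd (z j) * h (fst (z j)))"
  define r where "r = (\<Sum>j<m. h (fst (z j)))"
  have r: "0 \<le> r" unfolding r_def using nn by (intro sum_nonneg) auto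
  \<comment> \<open>If the nonnegative weights sum to zero, each one vanishes, and so does the
    numerator. Hence \<open>coeff_emp m h z * r = a\<close> survives the convention that the
    coefficient is then 0.\<close>
  have r0: "a = 0" if "r = 0"
  proof -
    have "\<And>j. j < m \<Longrightarrow> h (fst (z j)) = 0"
      using that nn unfolding r_def by (subst (asm) sum_nonneg_eq_0_iff) auto
    then show ?thesis by (simp add: a_def)
  qed
  have c: "coeff_emp m h z * r = a"
    using m r0 by (auto simp: coeff_emp_def rho_emp_def alpha_emp_def a_def r_def)
  have 1: "(\<Sum>j<m. (snd (z j) - e) * h (fst (z j))) = (coeff_emp m h z - e) * r"
    unfolding left_diff_distrib c by (simp add: a_def r_def sum_subtractf sum_distrib_left)
  have 2: "(\<Sum>j<m. (e - snd (z j)) * h (fst (z j))) = (e - coeff_emp m h z) * r"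
    unfolding left_diff_distrib c by (simp add: a_def r_def sum_subtractf sum_distrib_left)
  show "e \<le> coeff_emp m h z \<Longrightarrow> 0 \<le> (\<Sum>j<m. (snd (z j) - e) * h (fst (z j)))"
    and "coeff_emp m h z \<le> e \<Longrightarrow> 0 \<le> (\<Sum>j<m. (e - snd (z j)) * h (fst (z j)))"
    unfolding 1 2 using r by simp_all
qed

text \<open>The coefficient is a weighted average of labels, or 0 by convention.\<close>

lemma abs_coeff_emp_le:
  assumes m: "m \<ge> 1" and nn: "\<And>j. j < m \<Longrightarrow> 0 \<le> h (fst (z j))"
    and bd: "\<And>j. j < m \<Longrightarrow> \<bar>snd (z j)\<bar> \<le> A" and A: "0 \<le> A"
  shows "\<bar>coeff_emp m h z\<bar> \<le> A"
proof -
  have r: "0 \<le> rho_emp m h z"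
    unfolding rho_emp_def using nn by (intro divide_nonneg_nonneg sum_nonneg) auto
  have "\<bar>\<Sum>j<m. snd (z j) * h (fst (z j))\<bar> \<le> (\<Sum>j<m. \<bar>snd (z j) * h (fst (z j))\<bar>)"
    by (rule sum_abs)
  also have "\<dots> \<le> (\<Sum>j<m. A * h (fst (z j)))"
    using nn bd by (intro sum_mono) (auto simp: abs_mult intro!: mult_right_mono)
  finally have "\<bar>alpha_emp m h z\<bar> \<le> A * rho_emp m h z"
    using m by (simp add: alpha_emp_def rho_emp_def sum_distrib_left divide_right_mono)
  then show ?thesis
    using r A by (auto simp: coeff_emp_def abs_divide divide_le_eq)
qed

text \<open>The squared deviation is weighted by \<open>r\<close>, so the rate in the exponent,
  \<open>s\<^sup>2 * r = t\<close>, does not depend on the particular weight function. The event is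
  enclosed in a measurable \<open>E\<close> built from linear sums, which is all that a union bound
  asks for.\<close>

lemma coeff_emp_tail:
  assumes P: "prob_space \<rho>"
    and sets: "sets \<rho> = sets (X \<Otimes>\<^sub>M label_space A)"
    and D: "disintegration X (label_space A) \<rho> \<kappa>"
    and h [measurable]: "h \<in> borel_measurable X"
    and h01: "\<And>x. x \<in> space X \<Longrightarrow> 0 \<le> h x \<and> h x \<le> 1"
    and A: "A > 0" and m: "m \<ge> 1" and t: "t > 0"
  defines "c \<equiv> coeff_pop (marginal X \<rho>) h (regression_function \<kappa>)"
    and "r \<equiv> (\<integral>x. h x \<partial>marginal X \<rho>)"
    and "S \<equiv> PiM {..<m} (\<lambda>_. \<rho>)"
  shows "\<exists>E \<in> sets S. {z \<in> space S. t < (c - coeff_emp m h z)\<^sup>2 * r} \<subseteq> E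
    \<and> measure S E \<le> 2 * exp (- (real m * t / (64 * A\<^sup>2)))"
proof -
  interpret R: prob_space \<rho> by fact
  have [measurable_cong]: "sets \<rho> = sets (X \<Otimes>\<^sub>M label_space A)" by fact
  note [measurable] = measurable_snd_label_space[OF sets]
  have spR: "space \<rho> = space X \<times> {-A..A}"
    using sets_eq_imp_space_eq[OF sets] by (simp add: space_pair_measure space_label_space)
  have zj: "fst (z j) \<in> space X \<and> \<bar>snd (z j)\<bar> \<le> A" if "z \<in> space S" "j < m" for z j
    using that spR by (auto simp: S_def space_PiM PiE_iff mem_Times_iff abs_le_iff dest!: bspec)
  have r_eq: "r = (\<integral>z. h (fst z) \<partial>\<rho>)"
    unfolding r_def marginal_def by (rule integral_distr) measurable
  have ih: "integrable \<rho> (\<lambda>z. h (fst z))"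
    using spR h01 by (intro R.integrable_const_bound[where B = 1] AE_I2) auto
  have bd: "\<bar>snd z * h (fst z)\<bar> \<le> A * h (fst z)" if "z \<in> space \<rho>" for z
    using that spR h01[of "fst z"] by (auto simp: abs_mult intro!: mult_right_mono)
  have iyh: "integrable \<rho> (\<lambda>z. snd z * h (fst z))"
    using bd by (intro Bochner_Integration.integrable_bound[OF integrable_mult_right[OF ih, of A]] AE_I2)
      (auto intro: order_trans[OF _ abs_ge_self])
  have r0: "0 \<le> r"
    unfolding r_eq using spR h01 by (intro integral_nonneg_AE AE_I2) auto
  define a where "a = (\<integral>z. snd z * h (fst z) \<partial>\<rho>)"
  have c: "c = (if r = 0 then 0 else a / r)"
    unfolding c_def coeff_pop_def a_def r_def
    using integral_regression_function[OF P sets D h h01] by simp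
  have "\<bar>a\<bar> \<le> (\<integral>z. \<bar>snd z * h (fst z)\<bar> \<partial>\<rho>)"
    unfolding a_def by (rule integral_abs_bound)
  also have "\<dots> \<le> (\<integral>z. A * h (fst z) \<partial>\<rho>)"
    using bd iyh ih by (intro integral_mono) auto
  finally have "\<bar>a\<bar> \<le> A * r" by (simp add: r_eq)
  then have cA: "\<bar>c\<bar> \<le> A"
    using r0 A by (auto simp: c divide_le_eq)
  define s where "s = sqrt (t / r)"
  show ?thesis
  proof (cases "r > 0 \<and> s \<le> 2 * A")
    \<comment> \<open>Here no sample can deviate: \<open>r = 0\<close> would force
      \<open>t < 0\<close>, and otherwise the deviation would exceed \<open>2 * A\<close> although
      both coefficients lie between \<open>-A\<close> and \<open>A\<close>.\<close>
    case False
    have "{z \<in> space S. t < (c - coeff_emp m h z)\<^sup>2 * r} = {}"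
    proof (safe, simp)
      fix z assume z: "z \<in> space S" and tl: "t < (c - coeff_emp m h z)\<^sup>2 * r"
      have rp: "r > 0" using tl t r0 by (cases "r = 0") auto
      have "\<bar>coeff_emp m h z\<bar> \<le> A"
        using zj[OF z] h01 A m by (intro abs_coeff_emp_le) auto
      then have "\<bar>c - coeff_emp m h z\<bar> \<le> \<bar>2 * A\<bar>" using cA by linarith
      then have "(c - coeff_emp m h z)\<^sup>2 \<le> (2 * A)\<^sup>2" by (simp only: abs_le_square_iff)
      moreover have "t / r < (c - coeff_emp m h z)\<^sup>2" using tl rp by (simp add: divide_less_eq)
      ultimately have "s \<le> sqrt ((2 * A)\<^sup>2)" unfolding s_def by (intro real_sqrt_le_mono) simp
      then show False using False rp A unfolding real_sqrt_abs by simp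
    qed
    then show ?thesis by (intro bexI[of _ "{}"]) auto
  next
    case True
    then have rp: "r > 0" and s: "0 < s" "s \<le> 2 * A" using t by (auto simp: s_def)
    have s2: "s\<^sup>2 * r = t" using t rp by (simp add: s_def)
    have mean: "(\<integral>z. (snd z - c) * h (fst z) \<partial>\<rho>) = 0"
      using iyh ih rp by (simp add: left_diff_distrib c a_def r_eq)
    then have mean': "(\<integral>z. (c - snd z) * h (fst z) \<partial>\<rho>) = 0"
      using iyh ih by (simp add: left_diff_distrib)
    \<comment> \<open>\<open>E1\<close> captures overestimation by at least \<open>s\<close>,
      \<open>E2\<close> underestimation. Both are instances of the weighted tail bound with
      \<open>B = 2 * A\<close>, whence 16 * 4 = 64 in the exponent.\<close>
    define E1 where "E1 = {z \<in> space S. 0 \<le> (\<Sum>j<m. ((snd (z j) - c) - s) * h (fst (z j)))}"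
    define E2 where "E2 = {z \<in> space S. 0 \<le> (\<Sum>j<m. ((c - snd (z j)) - s) * h (fst (z j)))}"
    have E [measurable]: "E1 \<in> sets S" "E2 \<in> sets S"
      unfolding E1_def E2_def S_def by measurable
    have snd_c: "\<bar>snd z - c\<bar> \<le> 2 * A" "\<bar>c - snd z\<bar> \<le> 2 * A" "0 \<le> h (fst z) \<and> h (fst z) \<le> 1"
      if "z \<in> space \<rho>" for z
      using that spR cA h01[of "fst z"] by auto
    have "measure S E1 \<le> exp (- (real m * s\<^sup>2 * r / (16 * (2 * A)\<^sup>2)))"
      unfolding E1_def S_def r_eq using snd_c s mean
      by (intro R.prob_weighted_sum_nonneg_le) auto
    moreover have "measure S E2 \<le> exp (- (real m * s\<^sup>2 * r / (16 * (2 * A)\<^sup>2)))"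
      unfolding E2_def S_def r_eq using snd_c s mean'
      by (intro R.prob_weighted_sum_nonneg_le) auto
    moreover have "measure S (E1 \<union> E2) \<le> measure S E1 + measure S E2"
      using E by (rule measure_Un_le)
    ultimately have "measure S (E1 \<union> E2) \<le> 2 * exp (- (real m * t / (64 * A\<^sup>2)))"
      using s2 by (simp add: mult.assoc power_mult_distrib)
    moreover have "{z \<in> space S. t < (c - coeff_emp m h z)\<^sup>2 * r} \<subseteq> E1 \<union> E2"
    proof safe
      fix z assume z: "z \<in> space S" and tl: "t < (c - coeff_emp m h z)\<^sup>2 * r" and n: "z \<notin> E2"
      have nn: "0 \<le> h (fst (z j))" if "j < m" for j using zj[OF z that] h01 by auto
      have "s\<^sup>2 < (c - coeff_emp m h z)\<^sup>2" using tl rp unfolding s2[symmetric] by simp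
      then have "s < \<bar>c - coeff_emp m h z\<bar>"
        using s by (metis abs_of_pos abs_le_square_iff not_le)
      then consider "c + s \<le> coeff_emp m h z" | "coeff_emp m h z \<le> c - s" by linarith
      then show "z \<in> E1"
      proof cases
        case 1
        then show ?thesis
          using sum_diff_coeff_emp_nonneg(1)[where h = h and z = z, OF m nn, where e = "c + s"] z
          by (simp add: E1_def diff_diff_eq)
      next
        case 2
        then have "z \<in> E2"
          using sum_diff_coeff_emp_nonneg(2)[where h = h and z = z, OF m nn, where e = "c - s"] z
          by (simp add: E2_def algebra_simps)
        then show ?thesis using n by simp
      qed
    qed
    ultimately show ?thesis using E by (intro bexI[of _ "E1 \<union> E2"]) auto
  qed
qed

section \<open>From single coefficients to the estimator in the L2 norm\<close>

lemma L2_norm_partition_le: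
  assumes "prob_space \<mu>" and T: "finite T"
    and M: "\<And>v. v \<in> T \<Longrightarrow> M v \<in> borel_measurable \<mu>"
    and M01: "\<And>v x. v \<in> T \<Longrightarrow> x \<in> space \<mu> \<Longrightarrow> 0 \<le> M v x \<and> M v x \<le> 1"
    and M1: "\<And>x. x \<in> space \<mu> \<Longrightarrow> (\<Sum>v\<in>T. M v x) = 1"
  shows "(L2_norm \<mu> (\<lambda>x. (\<Sum>v\<in>T. a v * M v x) - (\<Sum>v\<in>T. b v * M v x)))\<^sup>2
    \<le> (\<Sum>v\<in>T. (a v - b v)\<^sup>2 * (\<integral>x. M v x \<partial>\<mu>))"
proof -
  interpret prob_space \<mu> by fact
  let ?g = "\<lambda>x. (\<Sum>v\<in>T. a v * M v x) - (\<Sum>v\<in>T. b v * M v x)"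
  have i: "integrable \<mu> (M v)" if "v \<in> T" for v
    using M[OF that] M01[OF that]
    by (intro integrable_const_bound[where B = 1] AE_I2) (auto simp: abs_le_iff)
  have pt: "(?g x)\<^sup>2 \<le> (\<Sum>v\<in>T. (a v - b v)\<^sup>2 * M v x)" if x: "x \<in> space \<mu>" for x
  proof -
    \<comment> \<open>Splitting \<open>M v x\<close> into two square roots lets Cauchy-Schwarz leave
      the factor \<open>\<Sum>v\<in>T. M v x = 1\<close> on one side.\<close>
    have "?g x = (\<Sum>v\<in>T. (sqrt (M v x) * (a v - b v)) * sqrt (M v x))"
      unfolding sum_subtractf[symmetric] using M01 x
      by (intro sum.cong) (auto simp: algebra_simps simp flip: real_sqrt_mult)
    then have "(?g x)\<^sup>2 \<le> (\<Sum>v\<in>T. (sqrt (M v x) * (a v - b v))\<^sup>2) * (\<Sum>v\<in>T. (sqrt (M v x))\<^sup>2)"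
      using Cauchy_Schwarz_ineq_sum by metis
    also have "(\<Sum>v\<in>T. (sqrt (M v x))\<^sup>2) = 1"
      using M01 M1 x by simp
    also have "(\<Sum>v\<in>T. (sqrt (M v x) * (a v - b v))\<^sup>2) = (\<Sum>v\<in>T. (a v - b v)\<^sup>2 * M v x)"
      using M01 x by (intro sum.cong) (auto simp: power_mult_distrib)
    finally show ?thesis by simp
  qed
  have int: "integrable \<mu> (\<lambda>x. \<Sum>v\<in>T. (a v - b v)\<^sup>2 * M v x)"
    using i by auto
  have "(L2_norm \<mu> ?g)\<^sup>2 = (\<integral>x. (?g x)\<^sup>2 \<partial>\<mu>)"
    by (simp add: L2_norm_def integral_nonneg_AE)
  also have "\<dots> \<le> (\<integral>x. (\<Sum>v\<in>T. (a v - b v)\<^sup>2 * M v x) \<partial>\<mu>)"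
    using pt int M01 by (intro integral_mono_AE' AE_I2) (auto intro!: sum_nonneg)
  also have "\<dots> = (\<Sum>v\<in>T. (a v - b v)\<^sup>2 * (\<integral>x. M v x \<partial>\<mu>))"
    using i by (subst Bochner_Integration.integral_sum) auto
  finally show ?thesis .
qed

lemma estimator_tail:
  assumes P: "prob_space \<rho>"
    and sets: "sets \<rho> = sets (X \<Otimes>\<^sub>M label_space A)"
    and D: "disintegration X (label_space A) \<rho> \<kappa>"
    and T: "finite T"
    and M: "\<And>v. v \<in> T \<Longrightarrow> M v \<in> borel_measurable X"
    and M01: "\<And>v x. v \<in> T \<Longrightarrow> x \<in> space X \<Longrightarrow> 0 \<le> M v x \<and> M v x \<le> 1"
    and M1: "\<And>x. x \<in> space X \<Longrightarrow> (\<Sum>v\<in>T. M v x) = 1"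
    and A: "A > 0" and m: "m \<ge> 1" and \<eta>: "\<eta> > 0"
  defines "\<mu> \<equiv> marginal X \<rho>" and "S \<equiv> PiM {..<m} (\<lambda>_. \<rho>)"
  shows "measure S {z \<in> space S.
      \<eta> < L2_norm \<mu> (\<lambda>x. quasi_proj \<mu> T M (regression_function \<kappa>) x - estimator m T M z x)}
    \<le> 2 * real (card T) * exp (- (real m * \<eta>\<^sup>2 / (64 * A\<^sup>2 * real (card T))))"
proof -
  interpret R: prob_space \<rho> by fact
  interpret S: product_prob_space "\<lambda>_::nat. \<rho>" "{..<m}" ..
  have [measurable_cong]: "sets \<rho> = sets (X \<Otimes>\<^sub>M label_space A)" by fact
  have U: "prob_space \<mu>"
    unfolding \<mu>_def marginal_def by (rule R.prob_space_distr) measurable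
  have mu: "space \<mu> = space X" "sets \<mu> = sets X" by (simp_all add: \<mu>_def marginal_def)
  have "space X \<noteq> {}" using prob_space.not_empty[OF U] mu by simp
  \<comment> \<open>An empty sum is 0, not 1, at a point of the nonempty space \<open>X\<close>;
    thus division by \<open>card T\<close> is legitimate.\<close>
  then have "T \<noteq> {}" using M1 by fastforce
  then have N: "card T > 0" using T by (simp add: card_gt_0_iff)
  define t where "t = \<eta>\<^sup>2 / card T"
  have t: "t > 0" using N \<eta> by (simp add: t_def)
  let ?c = "\<lambda>v. coeff_pop \<mu> (M v) (regression_function \<kappa>)"
  let ?B = "\<lambda>v. {z \<in> space S. t < (?c v - coeff_emp m (M v) z)\<^sup>2 * (\<integral>x. M v x \<partial>\<mu>)}"
  have "\<forall>v\<in>T. \<exists>E. E \<in> sets S \<and> ?B v \<subseteq> E \<and> measure S E \<le> 2 * exp (- (real m * t / (64 * A\<^sup>2)))"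
  proof
    fix v assume v: "v \<in> T"
    show "\<exists>E. E \<in> sets S \<and> ?B v \<subseteq> E \<and> measure S E \<le> 2 * exp (- (real m * t / (64 * A\<^sup>2)))"
      using coeff_emp_tail[OF P sets D M[OF v] M01[OF v] A m t]
      unfolding \<mu>_def S_def Bex_def by simp
  qed
  from bchoice[OF this] obtain E where
    EE: "\<forall>v\<in>T. E v \<in> sets S \<and> ?B v \<subseteq> E v \<and> measure S (E v) \<le> 2 * exp (- (real m * t / (64 * A\<^sup>2)))"
    by (elim exE)
  have E: "E v \<in> sets S" "?B v \<subseteq> E v" "measure S (E v) \<le> 2 * exp (- (real m * t / (64 * A\<^sup>2)))"
    if "v \<in> T" for v
    using bspec[OF EE that] by simp_all
  have sub: "{z \<in> space S.
      \<eta> < L2_norm \<mu> (\<lambda>x. quasi_proj \<mu> T M (regression_function \<kappa>) x - estimator m T M z x)}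
      \<subseteq> (\<Union>v\<in>T. E v)"
  proof safe
    fix z assume z: "z \<in> space S"
      and l: "\<eta> < L2_norm \<mu> (\<lambda>x. quasi_proj \<mu> T M (regression_function \<kappa>) x - estimator m T M z x)"
    have "(\<Sum>v\<in>T. t) = \<eta>\<^sup>2" using N by (simp add: t_def)
    also have "\<dots> < (L2_norm \<mu> (\<lambda>x. quasi_proj \<mu> T M (regression_function \<kappa>) x - estimator m T M z x))\<^sup>2"
      using l \<eta> by (intro power_strict_mono) auto
    also have "\<dots> \<le> (\<Sum>v\<in>T. (?c v - coeff_emp m (M v) z)\<^sup>2 * (\<integral>x. M v x \<partial>\<mu>))"
      unfolding quasi_proj_def estimator_def
      using T M M01 M1 mu by (intro L2_norm_partition_le[OF U]) (simp_all cong: measurable_cong_sets)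
    \<comment> \<open>Pigeonhole: \<open>t\<close> is the equal share of
      \<open>\<eta>\<^sup>2\<close>, so if no term exceeded it the sum would be at most
      \<open>\<eta>\<^sup>2\<close>.\<close>
    finally obtain v where "v \<in> T" "t < (?c v - coeff_emp m (M v) z)\<^sup>2 * (\<integral>x. M v x \<partial>\<mu>)"
      by (meson not_le sum_mono)
    then show "z \<in> (\<Union>v\<in>T. E v)" using E(2) z by blast
  qed
  have fin: "finite_measure S" unfolding S_def by unfold_locales
  have "measure S {z \<in> space S.
      \<eta> < L2_norm \<mu> (\<lambda>x. quasi_proj \<mu> T M (regression_function \<kappa>) x - estimator m T M z x)}
      \<le> measure S (\<Union>v\<in>T. E v)"
    using E(1) T by (intro finite_measure.finite_measure_mono[OF fin sub]) auto
  also have "\<dots> \<le> (\<Sum>v\<in>T. measure S (E v))"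
    using E(1) T by (intro finite_measure.finite_measure_subadditive_finite[OF fin]) auto
  also have "\<dots> \<le> (\<Sum>v\<in>T. 2 * exp (- (real m * t / (64 * A\<^sup>2))))"
    using E(3) by (rule sum_mono)
  finally show ?thesis by (simp add: t_def mult_ac)
qed

theorem theorem1p3:
  fixes A :: real
  assumes "A > 0"
  shows "\<exists>c>0. \<forall>d\<ge>1. \<forall>(\<rho> :: ((nat \<Rightarrow> real) \<times> real) measure) (\<kappa> :: (nat \<Rightarrow> real) \<Rightarrow> real measure)
             (T :: nat set) (M :: nat \<Rightarrow> (nat \<Rightarrow> real) \<Rightarrow> real).
           prob_space \<rho> \<longrightarrow>
           sets \<rho> = sets (cube_space d \<Otimes>\<^sub>M label_space A) \<longrightarrow>
           disintegration (cube_space d) (label_space A) \<rho> \<kappa> \<longrightarrow>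
           finite T \<longrightarrow>
           (\<forall>v\<in>T. M v \<in> borel_measurable (cube_space d)) \<longrightarrow>
           (\<forall>v\<in>T. \<forall>x\<in>space (cube_space d). 0 \<le> M v x \<and> M v x \<le> 1) \<longrightarrow>
           (\<forall>x\<in>space (cube_space d). (\<Sum>v\<in>T. M v x) = 1) \<longrightarrow>
           (\<forall>m\<ge>1. \<forall>\<eta>>0.
              measure (PiM {..<m} (\<lambda>_. \<rho>))
                {z \<in> space (PiM {..<m} (\<lambda>_. \<rho>)).
                   L2_norm (marginal (cube_space d) \<rho>)
                     (\<lambda>x. quasi_proj (marginal (cube_space d) \<rho>) T M (regression_function \<kappa>) x
                          - estimator m T M z x) > \<eta>}
              \<le> 4 * real (card T) * exp (- (c * real m * \<eta>\<^sup>2 / real (card T))))"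
proof (intro exI[of _ "1 / (64 * A\<^sup>2)"] conjI allI impI)
  show "0 < 1 / (64 * A\<^sup>2)" using assms by simp
next
  fix d :: nat and \<rho> :: "((nat \<Rightarrow> real) \<times> real) measure" and \<kappa> :: "(nat \<Rightarrow> real) \<Rightarrow> real measure"
    and T :: "nat set" and M :: "nat \<Rightarrow> (nat \<Rightarrow> real) \<Rightarrow> real" and m :: nat and \<eta> :: real
  assume H: "prob_space \<rho>" "sets \<rho> = sets (cube_space d \<Otimes>\<^sub>M label_space A)"
    "disintegration (cube_space d) (label_space A) \<rho> \<kappa>" "finite T"
    "\<forall>v\<in>T. M v \<in> borel_measurable (cube_space d)"
    "\<forall>v\<in>T. \<forall>x\<in>space (cube_space d). 0 \<le> M v x \<and> M v x \<le> 1"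
    "\<forall>x\<in>space (cube_space d). (\<Sum>v\<in>T. M v x) = 1" "1 \<le> m" "0 < \<eta>"
  let ?e = "exp (- (real m * \<eta>\<^sup>2 / (64 * A\<^sup>2 * real (card T))))"
  have "measure (PiM {..<m} (\<lambda>_. \<rho>)) {z \<in> space (PiM {..<m} (\<lambda>_. \<rho>)).
      \<eta> < L2_norm (marginal (cube_space d) \<rho>)
        (\<lambda>x. quasi_proj (marginal (cube_space d) \<rho>) T M (regression_function \<kappa>) x
             - estimator m T M z x)} \<le> 2 * real (card T) * ?e"
    using H assms by (intro estimator_tail) auto
  \<comment> \<open>Two deviation directions for each \<open>v\<close> give the factor 2, which is
    relaxed to 4.\<close>
  also have "\<dots> \<le> 4 * real (card T) * ?e"
    by (intro mult_right_mono) auto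
  also have "?e = exp (- (1 / (64 * A\<^sup>2) * real m * \<eta>\<^sup>2 / real (card T)))"
    by simp
  finally show "measure (PiM {..<m} (\<lambda>_. \<rho>)) {z \<in> space (PiM {..<m} (\<lambda>_. \<rho>)).
      \<eta> < L2_norm (marginal (cube_space d) \<rho>)
        (\<lambda>x. quasi_proj (marginal (cube_space d) \<rho>) T M (regression_function \<kappa>) x
             - estimator m T M z x)}
      \<le> 4 * real (card T) * exp (- (1 / (64 * A\<^sup>2) * real m * \<eta>\<^sup>2 / real (card T)))" .
qed

end
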